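(* Let $G=(V,E)$ be a finite connected planar graph embedded in the plane with real coupling constants, let $\mathcal N=\{v_1<\dots<v_{2n}\}$ be an ordered set of nodes on the outer face of $G$, and let $\mathcal B$ be a coloring of $\mathcal N$ with associated sources $\mathcal S_+$ and sinks $\mathcal S_-$. Then $$\sum_{S\in\mathcal P(\mathcal N)}(-1)^{|S\cap\mathcal B|}\,\mathrm{pf}(K^S)\,\mathrm{pf}(K^{\mathcal N\setminus S})=\begin{cases}2^{|\mathcal N|/2}\det(K^{\mathcal S_+,\mathcal S_-}) & \text{if } |\mathcal S_+|=|\mathcal S_-|,\\ 0&\text{otherwise.}\end{cases}$$
   Context: The Ashkin--Teller model on a finite graph $G=(V,E)$ with real coupling constants $J_e,U_e$ is the probability measure on pairs $(\sigma,\tilde\sigma)\in\{-1,1\}^V\times\{-1,1\}^V$ proportional to $\prod_{uv\in E}\exp\big(J_{uv}(\sigma_u\sigma_v+\tilde\sigma_u\tilde\sigma_v)+U_{uv}(\sigma_u\sigma_v\tilde\sigma_u\tilde\sigma_v+1)\big)$; $\langle\cdot\rangle$ is the expectation. Nodes: $\mathcal N$ consists of boundary vertices (vertices on the outer face), some of which may be doubled, i.e. included as two copies $v^<,v^>$; $|\mathcal N|=2n$ is even. The nodes are ordered counterclockwise along the outer face as $v_1<\dots<v_{2n}$ (if a vertex is visited several times by the boundary walk, one of its visits is fixed), with $v^>$ immediately after $v^<$. In correlations, nodes are projected to the underlying vertices ($\sigma_{v^<}=\sigma_{v^>}=\sigma_v$, so $\langle\sigma_{v^<}\sigma_{v^>}\rangle=1$).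 A coloring is a subset $\mathcal B\subseteq\mathcal N$ of blue nodes (both copies of a doubled vertex have the same color); $\mathcal R=\mathcal N\setminus\mathcal B$ are red. With $\mathcal N_e,\mathcal N_o$ the nodes of even and odd index, $$\mathcal S_+=(\mathcal N_o\cap\mathcal B)\cup(\mathcal N_e\cap\mathcal R),\qquad \mathcal S_-=(\mathcal N_e\cap\mathcal B)\cup(\mathcal N_o\cap\mathcal R).$$ $\mathcal P(\mathcal N)$ is the set of subsets of $\mathcal N$ of even cardinality. Matrices: $K$ is the antisymmetric $\mathcal N\times\mathcal N$ matrix with $K_{u,v}=\langle\sigma_u\sigma_v\rangle$ for $u<v$, $K_{u,v}=-\langle\sigma_u\sigma_v\rangle$ for $u>v$, and $K_{u,u}=0$. For $S\in\mathcal P(\mathcal N)$, $K^S$ is its restriction to rows and columns indexed by $S$, and its Pfaffian is $$\mathrm{pf}(K^S)=\sum_{\pi\in\Pi(S)}(-1)^{\mathrm{xg}(\pi)}\prod_{uv\in\pi}\langle\sigma_u\sigma_v\rangle,$$ where $\Pi(S)$ is the set of pairings of $S$ (partitions into sets of size two) and $\mathrm{xg}(\pi)$ is the number of unordered pairs of pairs $\{u,v\},\{u',v'\}\in\pi$ that cross, i.e. such that, up to relabelling, $u<u'<v<v'$; $\mathrm{pf}(K^\emptyset)=1$. When $|\mathcal S_+|=|\mathcal S_-|$, $K^{\mathcal S_+,\mathcal S_-}$ is the square matrix with rows indexed by $\mathcal S_+$ and columns by $\mathcal S_-$ (each in the order inherited from $\mathcal N$) and entries $$K^{\mathcal S_+,\mathcal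 S_-}_{u,v}=(-1)^{s(u,v)}\langle\sigma_u\sigma_v\rangle,\qquad u\in\mathcal S_+,\ v\in\mathcal S_-,$$ where $s(u,v)$ is the number of sources strictly between $u$ and $v$ in the order on $\mathcal N$. *)

theory Defs
  imports
    "HOL-Probability.Probability"
    "HOL-Complex_Analysis.Winding_Numbers"
    "Jordan_Normal_Form.Determinant"
begin

section \<open>Plane graphs and their boundary walk\<close>

text \<open>An edge is a two-element set of vertices; \<open>pos\<close> places the vertices in the plane and
  \<open>curve e\<close> is a simple arc drawing the edge \<open>e\<close> (traversed in either direction).\<close>

locale plane_graph =
  fixes V :: "'v set" and E :: "'v set set"
    and pos :: "'v \<Rightarrow> complex" and curve :: "'v set \<Rightarrow> real \<Rightarrow> complex"
  assumes finite_V: "finite V"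
    and nonempty_V: "V \<noteq> {}"
    and edges: "\<And>e. e \<in> E \<Longrightarrow> e \<subseteq> V \<and> card e = 2"
    and connected_graph: "\<And>u v. u \<in> V \<Longrightarrow> v \<in> V \<Longrightarrow> (u, v) \<in> {(a, b). {a, b} \<in> E}\<^sup>*"
    and inj_pos: "inj_on pos V"
    and arc_curve: "\<And>e. e \<in> E \<Longrightarrow> arc (curve e)"
    and ends_curve: "\<And>e. e \<in> E \<Longrightarrow> {pathstart (curve e), pathfinish (curve e)} = pos ` e"
    and curve_avoids_vertices:
      "\<And>e. e \<in> E \<Longrightarrow> path_image (curve e) \<inter> pos ` V = pos ` e"
    and curves_disjoint:
      "\<And>e e'. e \<in> E \<Longrightarrow> e' \<in> E \<Longrightarrow> e \<noteq> e' \<Longrightarrow>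
        path_image (curve e) \<inter> path_image (curve e') = pos ` (e \<inter> e')"

definition drawing ::
  "'v set \<Rightarrow> 'v set set \<Rightarrow> ('v \<Rightarrow> complex) \<Rightarrow> ('v set \<Rightarrow> real \<Rightarrow> complex) \<Rightarrow> complex set" where
  "drawing V E pos curve = pos ` V \<union> (\<Union>e\<in>E. path_image (curve e))"

text \<open>The outer face of a drawing \<open>D\<close> is \<^term>\<open>outside D\<close>.  Since \<open>D\<close> is connected,
  the outer face is a punctured disc (the puncture being infinity), and because \<open>D\<close> is a finite
  union of points and arcs, it has a parametrization by the exterior of the unit disc
  that extends continuously to the unit circle (for more than one vertex, the exterior Riemann map,
  by Caratheodory's theorem).  The winding number condition says that this parametrization
  preserves orientation.  Its trace on the unit circle is the counterclockwise closed walk around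
  the outer face: a vertex may be visited at several parameters.\<close>

definition outer_parametrization :: "complex set \<Rightarrow> (complex \<Rightarrow> complex) \<Rightarrow> bool" where
  "outer_parametrization D \<Phi> \<longleftrightarrow>
     continuous_on {z. 1 \<le> cmod z} \<Phi> \<and>
     (\<exists>\<Psi>. homeomorphism {z. 1 < cmod z} (outside D) \<Phi> \<Psi>) \<and>
     (\<forall>r>1. \<forall>p\<in>D. winding_number (\<Phi> \<circ> circlepath 0 r) p = 1)"

definition boundary_walk :: "complex set \<Rightarrow> (real \<Rightarrow> complex) \<Rightarrow> bool" where
  "boundary_walk D \<beta> \<longleftrightarrow> (\<exists>\<Phi>. outer_parametrization D \<Phi> \<and> \<beta> = (\<lambda>t. \<Phi> (cis t)))"

section \<open>Nodes, colorings, sources and sinks\<close>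

text \<open>The node \<open>v\<^sub>i\<close> is represented by its index \<open>i \<in> {1..2n}\<close>, so that the order of the nodes is
  the order of the naturals, and \<open>x i\<close> is the vertex underlying it.  The parameter \<open>t i\<close> is the
  chosen visit of \<open>x i\<close> by the boundary walk; the two copies of a doubled vertex share their visit.
  They are then consecutive because \<open>t\<close> is monotone and different vertices have different visits.
  The starting point of the enumeration is arbitrary.\<close>

definition nodes :: "nat \<Rightarrow> nat set" where
  "nodes n = {1..2 * n}"

definition boundary_nodes ::
  "'v set \<Rightarrow> 'v set set \<Rightarrow> ('v \<Rightarrow> complex) \<Rightarrow> ('v set \<Rightarrow> real \<Rightarrow> complex) \<Rightarrow>
   nat \<Rightarrow> (nat \<Rightarrow> 'v) \<Rightarrow> bool" where
  "boundary_nodes V E pos curve n x \<longleftrightarrow>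
     (\<exists>\<beta> t. boundary_walk (drawing V E pos curve) \<beta> \<and>
       (\<forall>i\<in>nodes n. x i \<in> V \<and> \<beta> (t i) = pos (x i)) \<and>
       mono_on (nodes n) t \<and>
       (\<forall>i\<in>nodes n. \<forall>j\<in>nodes n. t j < t i + 2 * pi) \<and>
       (\<forall>i\<in>nodes n. \<forall>j\<in>nodes n. x i = x j \<longrightarrow> t i = t j) \<and>
       (\<forall>v. card {i \<in> nodes n. x i = v} \<le> 2))"

definition coloring :: "nat \<Rightarrow> (nat \<Rightarrow> 'v) \<Rightarrow> nat set \<Rightarrow> bool" where
  "coloring n x B \<longleftrightarrow>
     B \<subseteq> nodes n \<and> (\<forall>i\<in>nodes n. \<forall>j\<in>nodes n. x i = x j \<longrightarrow> (i \<in> B \<longleftrightarrow> j \<in> B))"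

definition odd_nodes :: "nat \<Rightarrow> nat set" where
  "odd_nodes n = {i \<in> nodes n. odd i}"

definition even_nodes :: "nat \<Rightarrow> nat set" where
  "even_nodes n = {i \<in> nodes n. even i}"

definition sources :: "nat \<Rightarrow> nat set \<Rightarrow> nat set" where
  "sources n B = (odd_nodes n \<inter> B) \<union> (even_nodes n \<inter> (nodes n - B))"

definition sinks :: "nat \<Rightarrow> nat set \<Rightarrow> nat set" where
  "sinks n B = (even_nodes n \<inter> B) \<union> (odd_nodes n \<inter> (nodes n - B))"

definition even_subsets :: "nat set \<Rightarrow> nat set set" where
  "even_subsets N = {S. S \<subseteq> N \<and> even (card S)}"

section \<open>The Ashkin--Teller model\<close>

text \<open>For an edge \<open>e = {u, v}\<close>, the product of the spins over \<open>e\<close> is \<open>\<sigma>\<^sub>u \<sigma>\<^sub>v\<close>.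
  Spin configurations are extensional functions on \<open>V\<close>.\<close>

definition AT_configs :: "'v set \<Rightarrow> (('v \<Rightarrow> real) \<times> ('v \<Rightarrow> real)) set" where
  "AT_configs V = (V \<rightarrow>\<^sub>E {-1, 1}) \<times> (V \<rightarrow>\<^sub>E {-1, 1})"

definition AT_weight ::
  "'v set set \<Rightarrow> ('v set \<Rightarrow> real) \<Rightarrow> ('v set \<Rightarrow> real) \<Rightarrow>
   ('v \<Rightarrow> real) \<times> ('v \<Rightarrow> real) \<Rightarrow> real" where
  "AT_weight E J U = (\<lambda>(\<sigma>, \<sigma>').
     \<Prod>e\<in>E. exp (J e * ((\<Prod>v\<in>e. \<sigma> v) + (\<Prod>v\<in>e. \<sigma>' v))
               + U e * ((\<Prod>v\<in>e. \<sigma> v) * (\<Prod>v\<in>e. \<sigma>' v) + 1)))"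

definition AT_partition ::
  "'v set \<Rightarrow> 'v set set \<Rightarrow> ('v set \<Rightarrow> real) \<Rightarrow> ('v set \<Rightarrow> real) \<Rightarrow> real" where
  "AT_partition V E J U = (\<Sum>\<omega>\<in>AT_configs V. AT_weight E J U \<omega>)"

definition AT_model ::
  "'v set \<Rightarrow> 'v set set \<Rightarrow> ('v set \<Rightarrow> real) \<Rightarrow> ('v set \<Rightarrow> real) \<Rightarrow>
   (('v \<Rightarrow> real) \<times> ('v \<Rightarrow> real)) pmf" where
  "AT_model V E J U = embed_pmf
     (\<lambda>\<omega>. if \<omega> \<in> AT_configs V then AT_weight E J U \<omega> / AT_partition V E J U else 0)"

definition AT_corr ::
  "'v set \<Rightarrow> 'v set set \<Rightarrow> ('v set \<Rightarrow> real) \<Rightarrow> ('v set \<Rightarrow> real) \<Rightarrow> 'v \<Rightarrow> 'v \<Rightarrow> real" where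
  "AT_corr V E J U u v =
     measure_pmf.expectation (AT_model V E J U) (\<lambda>(\<sigma>, \<sigma>'). \<sigma> u * \<sigma> v)"

text \<open>The correlation of two nodes is that of their underlying vertices.\<close>

definition node_corr ::
  "'v set \<Rightarrow> 'v set set \<Rightarrow> ('v set \<Rightarrow> real) \<Rightarrow> ('v set \<Rightarrow> real) \<Rightarrow> (nat \<Rightarrow> 'v) \<Rightarrow>
   nat \<Rightarrow> nat \<Rightarrow> real" where
  "node_corr V E J U x i j = AT_corr V E J U (x i) (x j)"

lemma finite_AT_configs: "finite V \<Longrightarrow> finite (AT_configs V)"
  by (auto simp: AT_configs_def intro!: finite_PiE)

lemma AT_configs_nonempty: "AT_configs V \<noteq> {}"
  by (auto simp: AT_configs_def PiE_eq_empty_iff)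

lemma AT_weight_pos: "AT_weight E J U \<omega> > 0"
  by (auto simp: AT_weight_def split: prod.split intro!: prod_pos)

lemma AT_partition_pos: "finite V \<Longrightarrow> AT_partition V E J U > 0"
  unfolding AT_partition_def
  by (intro sum_pos finite_AT_configs AT_configs_nonempty AT_weight_pos)

lemma pmf_AT_model:
  assumes "finite V"
  shows "pmf (AT_model V E J U) \<omega> =
    (if \<omega> \<in> AT_configs V then AT_weight E J U \<omega> / AT_partition V E J U else 0)"
  unfolding AT_model_def
proof (rule pmf_embed_pmf)
  let ?f = "\<lambda>\<omega>. if \<omega> \<in> AT_configs V then AT_weight E J U \<omega> / AT_partition V E J U else 0"
  show nn: "\<And>\<omega>. 0 \<le> ?f \<omega>"
    using AT_partition_pos[OF assms, of E J U] AT_weight_pos[of E J U]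
    by (auto intro!: divide_nonneg_pos simp: less_imp_le)
  have "(\<integral>\<^sup>+\<omega>. ennreal (?f \<omega>) \<partial>count_space UNIV) = (\<Sum>\<omega>\<in>AT_configs V. ennreal (?f \<omega>))"
    by (rule nn_integral_count_space'[OF finite_AT_configs[OF assms]]) (auto split: if_splits)
  also have "\<dots> = ennreal (\<Sum>\<omega>\<in>AT_configs V. ?f \<omega>)"
    by (rule sum_ennreal) (rule nn)
  also have "(\<Sum>\<omega>\<in>AT_configs V. ?f \<omega>) = 1"
    using AT_partition_pos[OF assms, of E J U]
    by (simp add: sum_divide_distrib[symmetric] AT_partition_def[symmetric])
  finally show "(\<integral>\<^sup>+\<omega>. ennreal (?f \<omega>) \<partial>count_space UNIV) = 1" by simp
qed

section \<open>Pfaffians and the source-sink matrix\<close>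

text \<open>Here \<open>c u v\<close> stands for the correlation of the nodes \<open>u\<close> and \<open>v\<close>, and the nodes are ordered as
  natural numbers.\<close>

definition skew_matrix :: "(nat \<Rightarrow> nat \<Rightarrow> real) \<Rightarrow> nat \<Rightarrow> nat \<Rightarrow> real" where
  "skew_matrix c u v = (if u < v then c u v else if u > v then - c u v else 0)"

definition pairings :: "nat set \<Rightarrow> nat set set set" where
  "pairings S = {\<pi>. partition_on S \<pi> \<and> (\<forall>p\<in>\<pi>. card p = 2)}"

definition crossing :: "nat set \<Rightarrow> nat set \<Rightarrow> bool" where
  "crossing p q \<longleftrightarrow> (\<exists>u v u' v'. p = {u, v} \<and> q = {u', v'} \<and> u < u' \<and> u' < v \<and> v < v')"

text \<open>As \<open>crossing\<close> fixes which of the two pairs has the smallest element, every unordered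
  crossing is counted exactly once.\<close>

definition xg :: "nat set set \<Rightarrow> nat" where
  "xg \<pi> = card {(p, q). p \<in> \<pi> \<and> q \<in> \<pi> \<and> crossing p q}"

definition pf :: "(nat \<Rightarrow> nat \<Rightarrow> real) \<Rightarrow> nat set \<Rightarrow> real" where
  "pf K S = (\<Sum>\<pi>\<in>pairings S. (-1) ^ xg \<pi> * (\<Prod>p\<in>\<pi>. K (Min p) (Max p)))"

definition sources_between :: "nat \<Rightarrow> nat set \<Rightarrow> nat \<Rightarrow> nat \<Rightarrow> nat" where
  "sources_between n B u v = card {w \<in> sources n B. min u v < w \<and> w < max u v}"

definition source_sink_matrix ::
  "(nat \<Rightarrow> nat \<Rightarrow> real) \<Rightarrow> nat \<Rightarrow> nat set \<Rightarrow> real Matrix.mat" where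
  "source_sink_matrix c n B =
     Matrix.mat (card (sources n B)) (card (sinks n B))
       (\<lambda>(i, j). let u = sorted_list_of_set (sources n B) ! i;
                     v = sorted_list_of_set (sinks n B) ! j
                 in (-1) ^ sources_between n B u v * c u v)"

end

theory Submission
  imports Defs
begin

text \<open>Expanding both Pfaffians, the left-hand side becomes a sum over pairings \<open>\<pi>\<close> of all the nodes together
  with a subset \<open>A \<subseteq> \<pi>\<close>.  A pair \<open>{u, v}\<close> crosses as many pairs of \<open>\<pi>\<close>, modulo 2, as there are nodes
  strictly between \<open>u\<close> and \<open>v\<close>; hence replacing \<open>xg A + xg (\<pi> - A)\<close> by \<open>xg \<pi>\<close> costs a sign that is a
  product over the pairs of \<open>A\<close>.  The sum over \<open>A\<close> then factorizes over \<open>\<pi>\<close>: every pair joining a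
  source and a sink contributes 2, every other pair 0.  The surviving pairings correspond to
  permutations, and for two pairs \<open>{u, v}\<close>, \<open>{u', v'}\<close> with sources \<open>u\<close>, \<open>u'\<close>, crossing amounts, modulo 2,
  to the sum of the inversion indicator and the two indicators that one pair's source lies inside
  the other pair.\<close>

section \<open>Pairings and products of Pfaffians\<close>

text \<open>As \<open>crossing\<close> is directed, at most one of \<open>cross_sign p q\<close> and
  \<open>cross_sign q p\<close> is -1, and \<open>cross_sign p p\<close> is 1. A product over all
  ordered pairs thus counts each crossing once.\<close>

definition cross_sign :: "nat set \<Rightarrow> nat set \<Rightarrow> real" where
  "cross_sign p q = (if crossing p q then -1 else 1)"

definition pairing_weight :: "(nat \<Rightarrow> nat \<Rightarrow> real) \<Rightarrow> nat set set \<Rightarrow> real" where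
  "pairing_weight K \<pi> = (-1) ^ xg \<pi> * (\<Prod>p\<in>\<pi>. K (Min p) (Max p))"

lemma pf_eq_sum_pairing_weight: "pf K S = (\<Sum>\<pi>\<in>pairings S. pairing_weight K \<pi>)"
  by (simp add: pf_def pairing_weight_def)

lemma minus_one_power_card:
  "finite A \<Longrightarrow> (-1 :: real) ^ card {x\<in>A. P x} = (\<Prod>x\<in>A. if P x then -1 else 1)"
  by (simp add: prod.If_cases Collect_conj_eq)

text \<open>The multiplicative form lets the crossing sign be split along a subset of the pairing,
  or regrouped by pairs of indices.\<close>

lemma minus_one_power_xg:
  assumes "finite \<pi>"
  shows "(-1) ^ xg \<pi> = (\<Prod>p\<in>\<pi>. \<Prod>q\<in>\<pi>. cross_sign p q)"
proof -
  have "{(p, q). p \<in> \<pi> \<and> q \<in> \<pi> \<and> crossing p q} = {z\<in>\<pi> \<times> \<pi>. crossing (fst z) (snd z)}"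
    by auto
  then have "(-1 :: real) ^ xg \<pi> = (\<Prod>z\<in>\<pi> \<times> \<pi>. cross_sign (fst z) (snd z))"
    using minus_one_power_card[of "\<pi> \<times> \<pi>" "\<lambda>z. crossing (fst z) (snd z)"] assms
    by (simp add: xg_def cross_sign_def)
  then show ?thesis
    by (simp add: prod.cartesian_product case_prod_unfold)
qed

lemma cross_sign_square [simp]: "cross_sign p q * cross_sign p q = 1"
  by (simp add: cross_sign_def)

lemma crossing_doubleton:
  assumes "u < v" "u' < v'"
  shows "crossing {u, v} {u', v'} \<longleftrightarrow> u < u' \<and> u' < v \<and> v < v'"
proof
  assume "crossing {u, v} {u', v'}"
  then obtain a b a' b' where "{u, v} = {a, b}" "{u', v'} = {a', b'}" "a < a'" "a' < b" "b < b'"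
    unfolding crossing_def by blast
  with assms show "u < u' \<and> u' < v \<and> v < v'"
    unfolding doubleton_eq_iff by linarith
qed (auto simp: crossing_def)

lemma card_2_nat_obtain:
  assumes "card (p :: nat set) = 2"
  obtains u v where "u < v" "p = {u, v}" "Min p = u" "Max p = v"
proof -
  obtain a b where ab: "p = {a, b}" "a \<noteq> b"
    using assms by (meson card_2_iff)
  show thesis
    by (cases "a < b") (use ab that[of a b] that[of b a] in \<open>auto simp: insert_commute\<close>)
qed

section \<open>Pairings of a finite set and the product of two Pfaffians\<close>

lemma finite_pairings: "finite S \<Longrightarrow> finite (pairings S)"
  by (rule finite_subset[of _ "Pow (Pow S)"]) (auto simp: pairings_def partition_on_def)

lemma pairingsD:
  assumes "\<pi> \<in> pairings S"
  shows "\<Union>\<pi> = S" "disjoint \<pi>" "\<And>p. p \<in> \<pi> \<Longrightarrow> card p = 2" "\<And>p. p \<in> \<pi> \<Longrightarrow> finite p"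
proof -
  show "\<Union>\<pi> = S" "disjoint \<pi>" "\<And>p. p \<in> \<pi> \<Longrightarrow> card p = 2"
    using assms by (auto simp: pairings_def partition_on_def)
  then show "\<And>p. p \<in> \<pi> \<Longrightarrow> finite p"
    by (metis card.infinite zero_neq_numeral)
qed

lemma pairingsI:
  "\<Union>\<pi> = S \<Longrightarrow> disjoint \<pi> \<Longrightarrow> (\<And>p. p \<in> \<pi> \<Longrightarrow> card p = 2) \<Longrightarrow> \<pi> \<in> pairings S"
  unfolding pairings_def partition_on_def by fastforce

lemma finite_pairing: "\<pi> \<in> pairings S \<Longrightarrow> finite S \<Longrightarrow> finite \<pi>"
  using pairingsD(1) finite_UnionD by blast

lemma card_Union_pairing:
  assumes "\<pi> \<in> pairings S"
  shows "card S = 2 * card \<pi>"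
proof -
  have "card (\<Union>\<pi>) = (\<Sum>p\<in>\<pi>. card p)"
    using pairingsD[OF assms] by (intro card_Union_disjoint) (auto simp: disjoint_def pairwise_def)
  then show ?thesis
    using pairingsD[OF assms] by simp
qed

lemma pairings_subset: "\<pi> \<in> pairings S \<Longrightarrow> A \<subseteq> \<pi> \<Longrightarrow> A \<in> pairings (\<Union>A)"
  by (rule pairingsI) (use pairingsD pairwise_subset in blast)+

lemma Union_Diff_pairing:
  assumes "\<pi> \<in> pairings S" "A \<subseteq> \<pi>"
  shows "\<Union>(\<pi> - A) = S - \<Union>A"
proof -
  have "x \<notin> q" if "x \<in> p" "p \<in> \<pi> - A" "q \<in> A" for x p q
    using disjointD[OF pairingsD(2)[OF assms(1)], of p q] that assms(2) by auto
  then show ?thesis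
    using pairingsD(1)[OF assms(1)] by auto
qed

lemma pairings_Un:
  assumes "A \<in> pairings S" "A' \<in> pairings S'" "S \<inter> S' = {}"
  shows "A \<union> A' \<in> pairings (S \<union> S')" "A \<inter> A' = {}"
proof -
  note A = pairingsD[OF assms(1)] and A' = pairingsD[OF assms(2)]
  have *: "p \<inter> q = {}" if "p \<in> A" "q \<in> A'" for p q
    using that A(1) A'(1) assms(3) by auto
  have "disjoint (A \<union> A')"
    using A A' assms(3) by (intro disjoint_union) auto
  then show "A \<union> A' \<in> pairings (S \<union> S')"
    using A A' by (intro pairingsI) auto
  show "A \<inter> A' = {}"
  proof (intro equals0I)
    fix p assume "p \<in> A \<inter> A'"
    then show False
      using *[of p p] A(3)[of p] by auto
  qed
qed

text \<open>A pairing of \<open>S\<close> together with a pairing of \<open>N - S\<close> is the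
  same data as a pairing of \<open>N\<close> with a marked subset \<open>A\<close>: the two are
  glued in one direction, and \<open>S\<close> is recovered as \<open>\<Union>A\<close> in the
  other.\<close>

lemma sum_pf_mult_pf:
  assumes "finite N"
  shows "(\<Sum>S\<in>even_subsets N. g S * pf K S * pf K (N - S)) =
    (\<Sum>\<pi>\<in>pairings N. \<Sum>A\<in>Pow \<pi>. g (\<Union>A) * pairing_weight K A * pairing_weight K (\<pi> - A))"
proof -
  let ?P = "\<lambda>S. pairings S \<times> pairings (N - S)"
  have "(\<Sum>S\<in>even_subsets N. g S * pf K S * pf K (N - S)) =
    (\<Sum>S\<in>even_subsets N. \<Sum>z\<in>?P S. g S * pairing_weight K (fst z) * pairing_weight K (snd z))"
    unfolding pf_eq_sum_pairing_weight mult.assoc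
    unfolding sum_product
    unfolding sum_distrib_left
    unfolding sum.cartesian_product case_prod_unfold ..
  also have "\<dots> = (\<Sum>(S, z)\<in>Sigma (even_subsets N) ?P.
      g S * pairing_weight K (fst z) * pairing_weight K (snd z))"
    by (rule sum.Sigma)
      (use assms in \<open>auto simp: even_subsets_def intro!: finite_pairings finite_subset[of _ N]\<close>)
  also have "\<dots> = (\<Sum>(\<pi>, A)\<in>Sigma (pairings N) Pow.
      g (\<Union>A) * pairing_weight K A * pairing_weight K (\<pi> - A))"
  proof (rule sum.reindex_bij_witness[where i = "\<lambda>(\<pi>, A). (\<Union>A, A, \<pi> - A)"
        and j = "\<lambda>(S, A, A'). (A \<union> A', A)"])
    fix a assume "a \<in> Sigma (even_subsets N) ?P"
    then obtain S A A' where a: "a = (S, A, A')" "S \<subseteq> N" "A \<in> pairings S" "A' \<in> pairings (N - S)"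
      by (auto simp: even_subsets_def)
    have *: "A \<union> A' \<in> pairings N" "A \<inter> A' = {}"
      using pairings_Un[OF a(3,4)] a(2) by (auto simp: Un_absorb1)
    then have D: "A \<union> A' - A = A'"
      by auto
    show "(case case a of (S, A, A') \<Rightarrow> (A \<union> A', A) of (\<pi>, A) \<Rightarrow> (\<Union>A, A, \<pi> - A)) = a"
      using a pairingsD(1)[OF a(3)] D by simp
    show "(case a of (S, A, A') \<Rightarrow> (A \<union> A', A)) \<in> Sigma (pairings N) Pow"
      using a * by simp
    show "(case case a of (S, A, A') \<Rightarrow> (A \<union> A', A) of
        (\<pi>, A) \<Rightarrow> g (\<Union>A) * pairing_weight K A * pairing_weight K (\<pi> - A)) =
      (case a of (S, z) \<Rightarrow> g S * pairing_weight K (fst z) * pairing_weight K (snd z))"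
      using a pairingsD(1)[OF a(3)] D by simp
  next
    fix b assume "b \<in> Sigma (pairings N) Pow"
    then obtain \<pi> A where b: "b = (\<pi>, A)" "\<pi> \<in> pairings N" "A \<subseteq> \<pi>"
      by auto
    show "(case case b of (\<pi>, A) \<Rightarrow> (\<Union>A, A, \<pi> - A) of (S, A, A') \<Rightarrow> (A \<union> A', A)) = b"
      using b by auto
    have "\<Union>A \<subseteq> N"
      using b pairingsD(1) by blast
    \<comment> \<open>The restriction to even subsets costs nothing: \<open>\<Union>A\<close> has
      twice as many elements as \<open>A\<close> has pairs.\<close>
    then show "(case b of (\<pi>, A) \<Rightarrow> (\<Union>A, A, \<pi> - A)) \<in> Sigma (even_subsets N) ?P"
      using b pairings_subset[of \<pi> N A] pairings_subset[of \<pi> N "\<pi> - A"]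
        Union_Diff_pairing[OF b(2,3)] card_Union_pairing[of A "\<Union>A"]
      by (simp add: even_subsets_def)
  qed
  also have "\<dots> = (\<Sum>\<pi>\<in>pairings N. \<Sum>A\<in>Pow \<pi>.
      g (\<Union>A) * pairing_weight K A * pairing_weight K (\<pi> - A))"
    by (rule sum.Sigma[symmetric]) (use assms finite_pairing finite_pairings in auto)
  finally show ?thesis .
qed

section \<open>Crossing parity of a pair and splitting of the crossing sign\<close>

text \<open>A pair disjoint from \<open>{u, v}\<close> crosses it exactly when one of its elements
  lies strictly inside and the other outside. The case \<open>q = {u, v}\<close>, where both sides
  are 1, is included so that \<open>q\<close> can later range over a whole pairing.\<close>

lemma cross_sign_mult_swap:
  assumes "u < v" "card q = 2" "q = {u, v} \<or> q \<inter> {u, v} = {}"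
  shows "cross_sign {u, v} q * cross_sign q {u, v} =
    (\<Prod>w\<in>q. if u < w \<and> w < v then -1 else 1)"
proof -
  obtain u' v' where q: "u' < v'" "q = {u', v'}"
    using card_2_nat_obtain[OF assms(2)] by blast
  have "(\<Prod>w\<in>q. if u < w \<and> w < v then -1 else 1) =
      (if u < u' \<and> u' < v then -1 else 1) * (if u < v' \<and> v' < v then -1 else (1 :: real))"
    using q by simp
  moreover have "u = u' \<and> v = v' \<or> u \<noteq> u' \<and> u \<noteq> v' \<and> v \<noteq> u' \<and> v \<noteq> v'"
    using assms(1,3) q by (auto simp: doubleton_eq_iff)
  ultimately show ?thesis
    unfolding cross_sign_def q(2) crossing_doubleton[OF assms(1) q(1)] crossing_doubleton[OF q(1) assms(1)]
    using q(1) assms(1) by (elim disjE) (simp_all split: if_split, linarith?)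
qed

text \<open>The other pairs crossing \<open>p\<close> are those with exactly one element strictly between the two
  elements of \<open>p\<close>.\<close>

lemma prod_cross_sign_mult_swap:
  assumes "\<pi> \<in> pairings {a..b}" "p \<in> \<pi>"
  shows "(\<Prod>q\<in>\<pi>. cross_sign p q * cross_sign q p) = - (\<Prod>w\<in>p. (-1) ^ w)"
proof -
  note \<pi> = pairingsD[OF assms(1)]
  obtain u v where uv: "u < v" "p = {u, v}"
    using card_2_nat_obtain[OF \<pi>(3)[OF assms(2)]] by metis
  have sub: "u \<in> {a..b}" "v \<in> {a..b}"
    using UnionI[OF assms(2)] \<pi>(1) uv by auto
  have "(\<Prod>q\<in>\<pi>. cross_sign p q * cross_sign q p) =
    (\<Prod>q\<in>\<pi>. \<Prod>w\<in>q. if u < w \<and> w < v then -1 else 1)"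
  proof (rule prod.cong)
    fix q assume q: "q \<in> \<pi>"
    then have "q = {u, v} \<or> q \<inter> {u, v} = {}"
      using disjointD[OF \<pi>(2) q assms(2)] uv by auto
    then show "cross_sign p q * cross_sign q p = (\<Prod>w\<in>q. if u < w \<and> w < v then -1 else 1)"
      using cross_sign_mult_swap[OF uv(1) \<pi>(3)[OF q]] uv by simp
  qed simp
  \<comment> \<open>The pairs partition the interval, so the particular pairing no longer matters:
    what remains is the number of points between \<open>u\<close> and \<open>v\<close>.\<close>
  also have "\<dots> = (\<Prod>w\<in>\<Union>\<pi>. if u < w \<and> w < v then -1 else 1)"
    using \<pi>(2,4) by (simp add: prod.Union_disjoint_sets)
  also have "\<dots> = (-1) ^ card {w\<in>{a..b}. u < w \<and> w < v}"
    by (simp only: \<pi>(1) minus_one_power_card finite_atLeastAtMost)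
  also have "{w\<in>{a..b}. u < w \<and> w < v} = {u<..<v}"
    using sub by auto
  \<comment> \<open>The interval has no gaps, so there are \<open>v - u - 1\<close> such points. The
    off-by-one gives the leading minus sign, and \<open>v - u\<close> has the parity of
    \<open>u + v\<close>.\<close>
  also have "(-1 :: real) ^ card {u<..<v} = - ((-1) ^ u * (-1) ^ v)"
  proof -
    obtain k where "v = Suc (u + k)"
      using uv(1) less_iff_Suc_add by blast
    then show ?thesis
      by (simp add: power_add)
  qed
  finally show ?thesis
    using uv by simp
qed

text \<open>Adding up, over the pairs of \<open>A\<close>, the crossings with all of
  \<open>\<pi>\<close> counts those inside \<open>A\<close> twice and those between \<open>A\<close>
  and \<open>\<pi> - A\<close> once. The latter are exactly the crossings of \<open>\<pi>\<close>
  that are missing from \<open>xg A + xg (\<pi> - A)\<close>.\<close>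

lemma minus_one_power_xg_split:
  assumes "\<pi> \<in> pairings {a..b}" "A \<subseteq> \<pi>"
  shows "(-1) ^ xg A * (-1) ^ xg (\<pi> - A) =
    (-1) ^ xg \<pi> * (\<Prod>p\<in>A. - (\<Prod>w\<in>p. (-1 :: real) ^ w))"
proof -
  let ?C = "\<lambda>X Y. \<Prod>p\<in>X. \<Prod>q\<in>Y. cross_sign p q"
  have fin: "finite \<pi>" "finite A" "finite (\<pi> - A)"
    using finite_pairing[OF assms(1)] assms(2) finite_subset by auto
  have split: "prod f \<pi> = prod f A * prod f (\<pi> - A)" for f :: "nat set \<Rightarrow> real"
    using prod.subset_diff[OF assms(2) fin(1), of f] by (simp add: mult.commute)
  have sq: "?C X Y * ?C X Y = 1" for X Y
    by (simp add: prod.distrib[symmetric])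
  have "(\<Prod>p\<in>A. - (\<Prod>w\<in>p. (-1 :: real) ^ w)) =
    (\<Prod>p\<in>A. \<Prod>q\<in>\<pi>. cross_sign p q * cross_sign q p)"
    using assms by (intro prod.cong) (auto simp: prod_cross_sign_mult_swap)
  also have "\<dots> = ?C A \<pi> * ?C \<pi> A"
    by (simp add: prod.distrib prod.swap[of _ \<pi> A])
  \<comment> \<open>The factor with both pairs in \<open>A\<close> occurs as a square, hence drops
    out by \<open>sq\<close>.\<close>
  also have "\<dots> = (?C A A * ?C A A) * (?C A (\<pi> - A) * ?C (\<pi> - A) A)"
    by (simp add: split prod.distrib mult_ac)
  finally have R: "(\<Prod>p\<in>A. - (\<Prod>w\<in>p. (-1 :: real) ^ w)) = ?C A (\<pi> - A) * ?C (\<pi> - A) A"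
    by (simp only: sq mult_1)
  have "(-1) ^ xg \<pi> = ?C A A * ?C A (\<pi> - A) * (?C (\<pi> - A) A * ?C (\<pi> - A) (\<pi> - A))"
    by (simp add: minus_one_power_xg[OF fin(1)] split prod.distrib)
  then have "(-1) ^ xg \<pi> * (\<Prod>p\<in>A. - (\<Prod>w\<in>p. (-1 :: real) ^ w)) =
     ?C A A * ?C (\<pi> - A) (\<pi> - A) * ((?C A (\<pi> - A) * ?C A (\<pi> - A)) * (?C (\<pi> - A) A * ?C (\<pi> - A) A))"
    unfolding R by (simp only: mult_ac)
  then show ?thesis
    by (simp only: sq mult_1_right minus_one_power_xg[OF fin(2)] minus_one_power_xg[OF fin(3)])
qed

section \<open>Cancellation in the sum over subsets of a pairing\<close>

text \<open>Sources are the blue odd and the red even nodes, that is, those where the sign of the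
  color and the sign of the parity agree.\<close>

lemma source_sign:
  assumes "w \<in> nodes n"
  shows "(if w \<in> B then -1 else 1) * (-1) ^ w = (if w \<in> sources n B then 1 else - 1 :: real)"
  using assms by (auto simp: sources_def odd_nodes_def even_nodes_def)

text \<open>The two terms stand for leaving the pair out of \<open>A\<close> and for putting it into
  \<open>A\<close>. They cancel unless the product of the two signs is -1.\<close>

lemma one_minus_prod_sign:
  assumes "card p = 2"
  shows "1 - (\<Prod>w\<in>p. if w \<in> P then 1 else - 1 :: real) = (if card (p \<inter> P) = 1 then 2 else 0)"
proof -
  obtain u v where "p = {u, v}" "u \<noteq> v"
    using assms by (meson card_2_iff)
  then show ?thesis
    by (auto simp: Int_insert_left)
qed

text \<open>The edge factors of \<open>A\<close> and \<open>\<pi> - A\<close> always multiply to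
  those of \<open>\<pi>\<close>, so the dependence on \<open>A\<close> is a sign. By
  \<open>minus_one_power_xg_split\<close> and \<open>source_sign\<close>, this sign is a product
  over the pairs in \<open>A\<close>.\<close>

lemma sum_Pow_pairing_weight:
  assumes "\<pi> \<in> pairings (nodes n)"
  shows "(\<Sum>A\<in>Pow \<pi>. (-1) ^ card (\<Union>A \<inter> B) * pairing_weight K A * pairing_weight K (\<pi> - A)) =
    (if \<forall>p\<in>\<pi>. card (p \<inter> sources n B) = 1 then 2 ^ n * pairing_weight K \<pi> else 0)"
proof -
  let ?s = "\<lambda>w. if w \<in> sources n B then 1 else - 1 :: real"
  note \<pi> = pairingsD[OF assms]
  have fin: "finite \<pi>"
    using finite_pairing[OF assms] by (simp add: nodes_def)
  have card: "card \<pi> = n"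
    using card_Union_pairing[OF assms] by (simp add: nodes_def)
  have "(-1) ^ card (\<Union>A \<inter> B) * pairing_weight K A * pairing_weight K (\<pi> - A) =
      pairing_weight K \<pi> * (\<Prod>p\<in>A. - (\<Prod>w\<in>p. ?s w))" if A: "A \<subseteq> \<pi>" for A
  proof -
    have finA: "finite A"
      using A fin by (rule finite_subset)
    have "finite (\<Union>A)"
      using finA A \<pi>(4) by auto
    then have "(-1 :: real) ^ card (\<Union>A \<inter> B) = (\<Prod>w\<in>\<Union>A. if w \<in> B then -1 else 1)"
      using minus_one_power_card[of "\<Union>A" "\<lambda>w. w \<in> B"] by (simp only: Int_def Collect_mem_eq)
    also have "\<dots> = (\<Prod>p\<in>A. \<Prod>w\<in>p. if w \<in> B then -1 else 1)"
      using A \<pi>(4) pairwise_subset[OF \<pi>(2) A] by (subst prod.Union_disjoint_sets) auto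
    finally have "(-1) ^ card (\<Union>A \<inter> B) * (\<Prod>p\<in>A. - (\<Prod>w\<in>p. (-1 :: real) ^ w)) =
        (\<Prod>p\<in>A. - (\<Prod>w\<in>p. (if w \<in> B then -1 else 1) * (-1) ^ w))"
      by (simp add: prod.distrib flip: prod.distrib[of _ _ A])
    also have "\<dots> = (\<Prod>p\<in>A. - (\<Prod>w\<in>p. ?s w))"
    proof (intro prod.cong refl arg_cong[where f = uminus] source_sign)
      fix p w assume "p \<in> A" "w \<in> p"
      then show "w \<in> nodes n"
        using A \<pi>(1) by auto
    qed
    finally have sgn: "(-1) ^ card (\<Union>A \<inter> B) * (\<Prod>p\<in>A. - (\<Prod>w\<in>p. (-1 :: real) ^ w)) =
        (\<Prod>p\<in>A. - (\<Prod>w\<in>p. ?s w))" .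
    have xg: "(-1) ^ xg A * (-1) ^ xg (\<pi> - A) =
        (-1) ^ xg \<pi> * (\<Prod>p\<in>A. - (\<Prod>w\<in>p. (-1 :: real) ^ w))"
      using minus_one_power_xg_split[of \<pi> 1 "2 * n" A] assms A by (simp add: nodes_def)
    let ?k = "\<lambda>p. K (Min p) (Max p)"
    have "(-1) ^ card (\<Union>A \<inter> B) * pairing_weight K A * pairing_weight K (\<pi> - A) =
        (-1) ^ card (\<Union>A \<inter> B) * ((-1) ^ xg A * (-1) ^ xg (\<pi> - A)) * (prod ?k (\<pi> - A) * prod ?k A)"
      by (simp add: pairing_weight_def)
    also have "\<dots> = (-1) ^ xg \<pi> * prod ?k \<pi> *
        ((-1) ^ card (\<Union>A \<inter> B) * (\<Prod>p\<in>A. - (\<Prod>w\<in>p. (-1 :: real) ^ w)))"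
      unfolding xg prod.subset_diff[OF A fin, of ?k] by (simp only: mult_ac)
    finally show ?thesis
      unfolding sgn pairing_weight_def .
  qed
  then have "(\<Sum>A\<in>Pow \<pi>. (-1) ^ card (\<Union>A \<inter> B) * pairing_weight K A * pairing_weight K (\<pi> - A)) =
      (\<Sum>A\<in>Pow \<pi>. pairing_weight K \<pi> * (\<Prod>p\<in>A. - (\<Prod>w\<in>p. ?s w)))"
    by (intro sum.cong) auto
  \<comment> \<open>The sum over subsets is the expansion of a product over \<open>\<pi>\<close>:
    each pair chooses its sign (in \<open>A\<close>) or 1 (outside \<open>A\<close>).\<close>
  also have "\<dots> = pairing_weight K \<pi> * (\<Prod>p\<in>\<pi>. - (\<Prod>w\<in>p. ?s w) + 1)"
    by (simp only: prod_add[OF fin] sum_distrib_left prod.neutral_const mult_1_right)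
  also have "(\<Prod>p\<in>\<pi>. - (\<Prod>w\<in>p. ?s w) + 1) =
      (\<Prod>p\<in>\<pi>. if card (p \<inter> sources n B) = 1 then 2 else 0)"
    using one_minus_prod_sign[OF \<pi>(3)] by (intro prod.cong) auto
  also have "\<dots> = (if \<forall>p\<in>\<pi>. card (p \<inter> sources n B) = 1 then 2 ^ n else 0)"
  proof (cases "\<forall>p\<in>\<pi>. card (p \<inter> sources n B) = 1")
    case True
    then show ?thesis
      using card by simp
  next
    case False
    then show ?thesis
      using fin by (auto intro!: prod_zero)
  qed
  finally show ?thesis
    by simp
qed

text \<open>Each pair has one element in \<open>P\<close> and one outside. With sources for
  \<open>P\<close>, unequal numbers of sources and sinks leave no surviving pairing.\<close>

lemma card_eq_of_transversal_pairing:
  assumes "\<pi> \<in> pairings S" "finite S" "P \<subseteq> S" "\<forall>p\<in>\<pi>. card (p \<inter> P) = 1"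
  shows "card P = card (S - P)"
proof -
  note \<pi> = pairingsD[OF assms(1)]
  have "P = (\<Union>p\<in>\<pi>. p \<inter> P)"
    using assms(3) \<pi>(1) by auto
  also have "card \<dots> = (\<Sum>p\<in>\<pi>. card (p \<inter> P))"
    using finite_pairing[OF assms(1,2)] \<pi>(4) disjointD[OF \<pi>(2)]
    by (intro card_UN_disjoint) auto
  finally have "card P = card \<pi>"
    using assms(4) by simp
  then show ?thesis
    using card_Union_pairing[OF assms(1)] assms(2,3) by (simp add: card_Diff_subset finite_subset)
qed

section \<open>The sign of a permutation as a product over inversions\<close>

definition index_pairs :: "nat \<Rightarrow> (nat \<times> nat) set" where
  "index_pairs m = {(i, j). i < j \<and> j < m}"

lemma finite_index_pairs [simp]: "finite (index_pairs m)"
  by (rule finite_subset[of _ "{..<m} \<times> {..<m}"]) (auto simp: index_pairs_def)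

text \<open>The square of indices splits into the part above the diagonal, its mirror image, and the
  diagonal, where the factors are 1.\<close>

lemma prod_prod_eq_prod_index_pairs:
  fixes f :: "nat \<Rightarrow> nat \<Rightarrow> real"
  assumes "\<And>i. i < m \<Longrightarrow> f i i = 1"
  shows "(\<Prod>i = 0..<m. \<Prod>j = 0..<m. f i j) = (\<Prod>(i, j)\<in>index_pairs m. f i j * f j i)"
proof -
  let ?I = "index_pairs m" and ?D = "(\<lambda>i. (i, i)) ` {0..<m}"
  let ?g = "\<lambda>(i, j). f i j"
  have D: "{0..<m} \<times> {0..<m} = ?I \<union> (prod.swap ` ?I \<union> ?D)"
    by (auto simp: index_pairs_def image_iff)
  have disj: "?I \<inter> (prod.swap ` ?I \<union> ?D) = {}" "prod.swap ` ?I \<inter> ?D = {}"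
    by (auto simp: index_pairs_def)
  have "(\<Prod>i = 0..<m. \<Prod>j = 0..<m. f i j) = prod ?g ({0..<m} \<times> {0..<m})"
    by (rule prod.cartesian_product)
  also have "\<dots> = prod ?g ?I * (prod ?g (prod.swap ` ?I) * prod ?g ?D)"
    unfolding D using disj by (simp add: prod.union_disjoint)
  also have "prod ?g ?D = 1"
    using assms by (intro prod.neutral) auto
  also have "prod ?g (prod.swap ` ?I) = (\<Prod>(i, j)\<in>?I. f j i)"
    by (subst prod.reindex) (auto simp: case_prod_unfold)
  finally show ?thesis
    by (simp add: prod.distrib case_prod_unfold)
qed

text \<open>The elements of \<open>index_pairs m\<close> represent the two-element subsets of the
  index set, which \<open>\<sigma>\<close> permutes. Since \<open>f\<close> is symmetric,
  \<open>min\<close> and \<open>max\<close> may restore the order of the images.\<close>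

lemma prod_index_pairs_permute:
  fixes f :: "nat \<Rightarrow> nat \<Rightarrow> real"
  assumes "\<sigma> permutes {0..<m}" and sym: "\<And>i j. f i j = f j i"
  shows "(\<Prod>(i, j)\<in>index_pairs m. f (\<sigma> i) (\<sigma> j)) = (\<Prod>(i, j)\<in>index_pairs m. f i j)"
proof -
  let ?j = "\<lambda>\<sigma> (i, j). (min (\<sigma> i) (\<sigma> j), max (\<sigma> i) (\<sigma> j :: nat))"
  have lt: "\<tau> i < m" if "\<tau> permutes {0..<m}" "i < m" for \<tau> i
    using permutes_in_image[OF that(1), of i] that(2) by simp
  have ne: "\<tau> i \<noteq> \<tau> j" if "\<tau> permutes {0..<m}" "i \<noteq> j" for \<tau> i j
    using permutes_inj[OF that(1)] that(2) by (auto dest: injD)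
  have into: "?j \<tau> z \<in> index_pairs m" if "\<tau> permutes {0..<m}" "z \<in> index_pairs m" for \<tau> z
  proof -
    obtain i j where z: "z = (i, j)" "i < j" "j < m"
      using \<open>z \<in> index_pairs m\<close> by (auto simp: index_pairs_def)
    then show ?thesis
      using lt[OF that(1), of i] lt[OF that(1), of j] ne[OF that(1), of i j]
      by (auto simp: index_pairs_def min_def max_def)
  qed
  have inv: "?j \<tau> (?j \<rho> z) = z" if "\<And>x. \<tau> (\<rho> x) = x" "z \<in> index_pairs m" for \<tau> \<rho> z
    using that by (auto simp: index_pairs_def min_def max_def)
  have P: "inv_into UNIV \<sigma> permutes {0..<m}"
    "\<And>x. inv_into UNIV \<sigma> (\<sigma> x) = x" "\<And>x. \<sigma> (inv_into UNIV \<sigma> x) = x"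
    using permutes_inv[OF assms(1)] permutes_inverses[OF assms(1)] by auto
  show ?thesis
  proof (rule prod.reindex_bij_witness[where i = "?j (inv_into UNIV \<sigma>)" and j = "?j \<sigma>"])
    fix z assume "z \<in> index_pairs m"
    then show "(case ?j \<sigma> z of (i, j) \<Rightarrow> f i j) = (case z of (i, j) \<Rightarrow> f (\<sigma> i) (\<sigma> j))"
      by (auto simp: min_def max_def sym split: prod.split)
  qed (use into[OF P(1)] into[OF assms(1)] inv[of \<sigma> "inv_into UNIV \<sigma>"]
      inv[of "inv_into UNIV \<sigma>" \<sigma>] P(2,3) in auto)
qed

text \<open>The inverted pairs are \<open>(a, b)\<close> itself and, for each \<open>k\<close>
  strictly between, \<open>(a, k)\<close> and \<open>(k, b)\<close>: an odd number.\<close>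

lemma prod_inversions_transpose:
  assumes "a < b" "b < m"
  shows "(\<Prod>(i, j)\<in>index_pairs m.
    if Transposition.transpose a b i < Transposition.transpose a b j \<longleftrightarrow> i < j then 1 else - 1 :: real) = - 1"
proof -
  let ?t = "Transposition.transpose a b"
  let ?L = "Pair a ` {a<..<b}" and ?R = "(\<lambda>i. (i, b)) ` {a<..<b}"
  have "{z \<in> index_pairs m. \<not> (?t (fst z) < ?t (snd z) \<longleftrightarrow> fst z < snd z)} =
      insert (a, b) (?L \<union> ?R)"
  proof (rule Set.set_eqI)
    fix z :: "nat \<times> nat"
    obtain i j where z: "z = (i, j)"
      by (cases z)
    have "(i, j) \<in> insert (a, b) (?L \<union> ?R) \<longleftrightarrow>
        i = a \<and> j = b \<or> i = a \<and> a < j \<and> j < b \<or> a < i \<and> i < b \<and> j = b"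
      by auto
    then show "z \<in> {z \<in> index_pairs m. \<not> (?t (fst z) < ?t (snd z) \<longleftrightarrow> fst z < snd z)} \<longleftrightarrow>
        z \<in> insert (a, b) (?L \<union> ?R)"
      unfolding z using assms by (simp add: index_pairs_def Transposition.transpose_def) linarith
  qed
  moreover have "card (insert (a, b) (?L \<union> ?R)) = Suc (2 * card {a<..<b})"
  proof -
    have "card (?L \<union> ?R) = card ?L + card ?R"
      using assms by (intro card_Un_disjoint) auto
    also have "\<dots> = 2 * card {a<..<b}"
      by (simp add: card_image inj_on_def)
    finally show ?thesis
      by (subst card_insert_disjoint) auto
  qed
  moreover have "(\<Prod>(i, j)\<in>index_pairs m. if ?t i < ?t j \<longleftrightarrow> i < j then 1 else - 1 :: real) =
      (-1) ^ card {z \<in> index_pairs m. \<not> (?t (fst z) < ?t (snd z) \<longleftrightarrow> fst z < snd z)}"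
    unfolding minus_one_power_card[OF finite_index_pairs] case_prod_unfold
    by (intro prod.cong) auto
  ultimately show ?thesis
    by simp
qed

text \<open>Induction over transpositions: composing with \<open>?t\<close> multiplies the inversion
  indicator of \<open>(i, j)\<close> by the sign telling whether \<open>?t\<close> reverses the
  order of \<open>p i\<close> and \<open>p j\<close>.\<close>

lemma sign_eq_prod_inversions:
  assumes "\<sigma> permutes {0..<m}"
  shows "of_int (sign \<sigma>) = (\<Prod>(i, j)\<in>index_pairs m. if \<sigma> i < \<sigma> j then 1 else - 1 :: real)"
  using assms finite_atLeastLessThan[of 0 m]
proof (induction rule: permutes_induct)
  case id
  have "(\<Prod>(i, j)\<in>index_pairs m. if id i < id j then 1 else - 1 :: real) = 1"
    by (intro prod.neutral) (auto simp: index_pairs_def)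
  then show ?case
    by simp
next
  case (swap a b p)
  let ?t = "Transposition.transpose a b"
  let ?f = "\<lambda>i j. if ?t i < ?t j \<longleftrightarrow> i < j then 1 else - 1 :: real"
  \<comment> \<open>Comparing the order before and after \<open>?t\<close>, rather than only after,
    makes the factor symmetric, as reindexing by \<open>p\<close> requires.\<close>
  have sym: "?f i j = ?f j i" for i j
    using injD[OF inj_transpose[of a b], of i j] by (cases i j rule: linorder_cases) auto
  have "(\<Prod>(i, j)\<in>index_pairs m. ?f i j) = - 1"
  proof (cases "a < b")
    case True
    then show ?thesis
      using prod_inversions_transpose[of a b m] swap by simp
  next
    case False
    then show ?thesis
      using prod_inversions_transpose[of b a m] swap by (simp add: Transposition.transpose_commute)
  qed
  then have "- 1 = (\<Prod>(i, j)\<in>index_pairs m. ?f (p i) (p j))"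
    using prod_index_pairs_permute[OF \<open>p permutes {0..<m}\<close>, of ?f, OF sym] by simp
  then have "of_int (sign (?t \<circ> p)) = (\<Prod>(i, j)\<in>index_pairs m. ?f (p i) (p j)) *
      (\<Prod>(i, j)\<in>index_pairs m. if p i < p j then 1 else - 1 :: real)"
    using swap permutation_permutes[of p]
    by (subst sign_compose) (auto simp: permutation_swap_id sign_swap_id)
  also have "\<dots> = (\<Prod>(i, j)\<in>index_pairs m. if (?t \<circ> p) i < (?t \<circ> p) j then 1 else - 1)"
    unfolding case_prod_unfold prod.distrib[symmetric]
    by (intro prod.cong) auto
  finally show ?case .
qed

section \<open>Source-sink pairings and permutations\<close>

lemma crossing_doubleton_min_max:
  assumes "x \<noteq> y" "x' \<noteq> y'"
  shows "crossing {x, y} {x', y'} \<longleftrightarrow>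
    min x y < min x' y' \<and> min x' y' < max x y \<and> max x y < max x' y'"
proof -
  have "{x, y} = {min x y, max x y}" "{x', y'} = {min x' y', max x' y'}"
    by (auto simp: min_def max_def)
  moreover have "min x y < max x y" "min x' y' < max x' y'"
    using assms by (auto simp: min_def max_def)
  ultimately show ?thesis
    using crossing_doubleton by metis
qed

text \<open>Both sides change sign exactly when \<open>y\<close> passes \<open>x'\<close> or
  \<open>y'\<close>, or \<open>y'\<close> passes \<open>x\<close> or \<open>y\<close>, and both are
  1 for \<open>x < y < x' < y'\<close>. The proof checks the possible orders directly.\<close>

lemma cross_sign_mult_swap_eq_inversion:
  assumes "x < x'" "x \<noteq> y" "x \<noteq> y'" "x' \<noteq> y" "x' \<noteq> y'" "y \<noteq> y'"
  shows "cross_sign {x, y} {x', y'} * cross_sign {x', y'} {x, y} =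
    (if y < y' then 1 else - 1) *
    ((if min x y < x' \<and> x' < max x y then - 1 else 1) *
     (if min x' y' < x \<and> x < max x' y' then - 1 else 1))"
proof -
  have c: "cross_sign {x, y} {x', y'} =
      (if min x y < min x' y' \<and> min x' y' < max x y \<and> max x y < max x' y' then - 1 else 1)"
    "cross_sign {x', y'} {x, y} =
      (if min x' y' < min x y \<and> min x y < max x' y' \<and> max x' y' < max x y then - 1 else 1)"
    using assms by (simp_all add: cross_sign_def crossing_doubleton_min_max)
  \<comment> \<open>Given \<open>x < x'\<close>, each betweenness test reduces to a single
    comparison.\<close>
  have m: "min x y < x'" "x < max x' y'" "x' < max x y \<longleftrightarrow> x' < y" "min x' y' < x \<longleftrightarrow> y' < x"
    using \<open>x < x'\<close> by auto
  consider "y < x" | "x < y" "y < x'" | "x' < y"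
    using assms by linarith
  then show ?thesis
  proof cases
    case 1
    then have "min x y = y" "max x y = x"
      by auto
    with 1 assms show ?thesis
      unfolding c m by (cases "y' < x'"; cases "y' < x"; cases "y < y'"; simp)
  next
    case 2
    then have e: "min x y = x" "max x y = y"
      by auto
    consider "y' < x" | "x < y'" "y' < y" | "y < y'" "y' < x'" | "x' < y'"
      using assms by linarith
    then show ?thesis
      unfolding c m e using \<open>x < x'\<close> 2 by cases simp_all
  next
    case 3
    then have "min x y = x" "max x y = y"
      using \<open>x < x'\<close> by auto
    with 3 assms show ?thesis
      unfolding c m by (cases "y' < x'"; cases "y' < x"; cases "y < y'"; simp)
  qed
qed

section \<open>Pairings between two increasing sequences, and the Leibniz formula\<close>

context
  fixes a b :: "nat \<Rightarrow> nat" and m :: nat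
  assumes a_mono: "\<And>i j. i < j \<Longrightarrow> j < m \<Longrightarrow> a i < a j"
    and b_mono: "\<And>i j. i < j \<Longrightarrow> j < m \<Longrightarrow> b i < b j"
    and a_neq_b: "\<And>i j. i < m \<Longrightarrow> j < m \<Longrightarrow> a i \<noteq> b j"
begin

text \<open>This is the pairing read off from the Leibniz term of \<open>\<sigma>\<close>: row
  \<open>i\<close> belongs to \<open>a i\<close> and column \<open>\<sigma> i\<close> to
  \<open>b (\<sigma> i)\<close>.\<close>

definition permutation_pairing :: "(nat \<Rightarrow> nat) \<Rightarrow> nat set set" where
  "permutation_pairing \<sigma> = (\<lambda>i. {a i, b (\<sigma> i)}) ` {0..<m}"

lemma a_eq_iff: "i < m \<Longrightarrow> j < m \<Longrightarrow> a i = a j \<longleftrightarrow> i = j"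
  using a_mono[of i j] a_mono[of j i] by (cases i j rule: linorder_cases) auto

lemma b_eq_iff: "i < m \<Longrightarrow> j < m \<Longrightarrow> b i = b j \<longleftrightarrow> i = j"
  using b_mono[of i j] b_mono[of j i] by (cases i j rule: linorder_cases) auto

lemma b_less_iff: "i < m \<Longrightarrow> j < m \<Longrightarrow> b i < b j \<longleftrightarrow> i < j"
  using b_mono[of i j] b_mono[of j i] by (cases i j rule: linorder_cases) auto

lemma permutes_less: "\<sigma> permutes {0..<m} \<Longrightarrow> i < m \<Longrightarrow> \<sigma> i < m"
  using permutes_in_image[of \<sigma> "{0..<m}" i] by simp

lemma pair_Int:
  assumes "i < m" "j < m"
  shows "{a i, b j} \<inter> a ` {0..<m} = {a i}"
  using assms a_neq_b by auto

lemma pair_eq_iff: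
  assumes "i < m" "k < m" "j < m" "l < m"
  shows "{a i, b k} = {a j, b l} \<longleftrightarrow> i = j \<and> k = l"
  unfolding doubleton_eq_iff
  using a_neq_b[OF assms(1,4)] a_eq_iff[OF assms(1,3)] b_eq_iff[OF assms(2,4)] by simp

lemma inj_on_permutation_pairing:
  assumes "\<sigma> permutes {0..<m}"
  shows "inj_on (\<lambda>i. {a i, b (\<sigma> i)}) {0..<m}"
proof (rule inj_onI)
  fix i j assume "i \<in> {0..<m}" "j \<in> {0..<m}" "{a i, b (\<sigma> i)} = {a j, b (\<sigma> j)}"
  then show "i = j"
    using pair_eq_iff[of i "\<sigma> i" j "\<sigma> j"] permutes_less[OF assms] by simp
qed

text \<open>\<open>cross_sign_mult_swap_eq_inversion\<close> applies to each \<open>i < j\<close>.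
  The inversion factors multiply to the sign of \<open>\<sigma>\<close>; the others, regrouped by
  rows, count the sources strictly inside each pair and become the signs of the matrix
  entries.\<close>

lemma minus_one_power_xg_permutation_pairing:
  assumes "\<sigma> permutes {0..<m}"
  shows "(-1 :: real) ^ xg (permutation_pairing \<sigma>) = of_int (sign \<sigma>) *
    (\<Prod>i = 0..<m. (-1) ^ card {w \<in> a ` {0..<m}. min (a i) (b (\<sigma> i)) < w \<and> w < max (a i) (b (\<sigma> i))})"
proof -
  let ?p = "\<lambda>i. {a i, b (\<sigma> i)}"
  let ?between = "\<lambda>i w. min (a i) (b (\<sigma> i)) < w \<and> w < max (a i) (b (\<sigma> i))"
  let ?s = "\<lambda>i j. if ?between i (a j) then - 1 else 1 :: real"
  have inj_a: "inj_on a {0..<m}"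
    using a_eq_iff by (auto intro: inj_onI)
  have "(\<Prod>i = 0..<m. (-1 :: real) ^ card {w \<in> a ` {0..<m}. ?between i w}) =
      (\<Prod>i = 0..<m. \<Prod>j = 0..<m. ?s i j)"
    unfolding minus_one_power_card[OF finite_imageI[OF finite_atLeastLessThan]]
    by (simp only: prod.reindex[OF inj_a] comp_def)
  \<comment> \<open>The diagonal is harmless because \<open>a i\<close> is an endpoint of its own
    pair, hence not strictly between.\<close>
  also have "\<dots> = (\<Prod>(i, j)\<in>index_pairs m. ?s i j * ?s j i)"
    by (rule prod_prod_eq_prod_index_pairs) (auto simp: min_def max_def)
  finally have s: "(\<Prod>i = 0..<m. (-1 :: real) ^ card {w \<in> a ` {0..<m}. ?between i w}) = \<dots>" .
  have "(-1) ^ xg (permutation_pairing \<sigma>) =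
      (\<Prod>i = 0..<m. \<Prod>j = 0..<m. cross_sign (?p i) (?p j))"
    unfolding permutation_pairing_def minus_one_power_xg[OF finite_imageI[OF finite_atLeastLessThan]]
    by (simp only: prod.reindex[OF inj_on_permutation_pairing[OF assms]] comp_def)
  also have "\<dots> = (\<Prod>(i, j)\<in>index_pairs m. cross_sign (?p i) (?p j) * cross_sign (?p j) (?p i))"
  proof (rule prod_prod_eq_prod_index_pairs)
    fix i assume "i < m"
    then show "cross_sign (?p i) (?p i) = 1"
      using a_neq_b[of i "\<sigma> i"] permutes_less[OF assms]
      by (simp add: cross_sign_def crossing_doubleton_min_max)
  qed
  also have "\<dots> = (\<Prod>(i, j)\<in>index_pairs m. (if \<sigma> i < \<sigma> j then 1 else - 1) * (?s i j * ?s j i))"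
  proof (intro prod.cong refl)
    fix z assume "z \<in> index_pairs m"
    then obtain i j where z: "z = (i, j)" "i < j" "j < m"
      by (auto simp: index_pairs_def)
    then have \<sigma>: "\<sigma> i < m" "\<sigma> j < m" "\<sigma> i \<noteq> \<sigma> j"
      using permutes_less[OF assms] permutes_inj[OF assms] by (auto dest: injD)
    have "cross_sign (?p i) (?p j) * cross_sign (?p j) (?p i) =
        (if b (\<sigma> i) < b (\<sigma> j) then 1 else - 1) * (?s i j * ?s j i)"
      using z \<sigma> a_mono[OF z(2,3)]
      by (intro cross_sign_mult_swap_eq_inversion) (simp_all add: a_neq_b b_eq_iff)
    then show "(case z of (i, j) \<Rightarrow> cross_sign (?p i) (?p j) * cross_sign (?p j) (?p i)) =
        (case z of (i, j) \<Rightarrow> (if \<sigma> i < \<sigma> j then 1 else - 1) * (?s i j * ?s j i))"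
      unfolding z b_less_iff[OF \<sigma>(1,2)] by (simp only: prod.case)
  qed
  also have "\<dots> = of_int (sign \<sigma>) * (\<Prod>(i, j)\<in>index_pairs m. ?s i j * ?s j i)"
    unfolding sign_eq_prod_inversions[OF assms] case_prod_unfold by (rule prod.distrib)
  finally show ?thesis
    by (simp only: s)
qed

text \<open>The smaller element comes first in the Pfaffian, so \<open>skew_matrix\<close>
  contributes \<open>c\<close> without a sign; symmetry of \<open>c\<close> then allows the source
  to be written first.\<close>

lemma pairing_weight_permutation_pairing:
  assumes "\<sigma> permutes {0..<m}" and sym: "\<And>u v. c u v = c v u"
  shows "pairing_weight (skew_matrix c) (permutation_pairing \<sigma>) = of_int (sign \<sigma>) *
    (\<Prod>i = 0..<m. (-1) ^ card {w \<in> a ` {0..<m}. min (a i) (b (\<sigma> i)) < w \<and> w < max (a i) (b (\<sigma> i))} *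
      c (a i) (b (\<sigma> i)))"
proof -
  have "(\<Prod>p\<in>permutation_pairing \<sigma>. skew_matrix c (Min p) (Max p)) =
      (\<Prod>i = 0..<m. skew_matrix c (Min {a i, b (\<sigma> i)}) (Max {a i, b (\<sigma> i)}))"
    by (simp add: permutation_pairing_def prod.reindex[OF inj_on_permutation_pairing[OF assms(1)]])
  also have "\<dots> = (\<Prod>i = 0..<m. c (a i) (b (\<sigma> i)))"
  proof (intro prod.cong refl)
    fix i assume "i \<in> {0..<m}"
    then have "a i \<noteq> b (\<sigma> i)"
      using a_neq_b permutes_less[OF assms(1)] by simp
    then show "skew_matrix c (Min {a i, b (\<sigma> i)}) (Max {a i, b (\<sigma> i)}) = c (a i) (b (\<sigma> i))"
      using sym[of "a i" "b (\<sigma> i)"] by (simp add: skew_matrix_def min_def max_def)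
  qed
  finally show ?thesis
    by (simp add: pairing_weight_def minus_one_power_xg_permutation_pairing[OF assms(1)] prod.distrib)
qed

text \<open>In a transversal pairing the partner of each \<open>a i\<close> is some
  \<open>b j\<close>, and disjointness of the pairs makes \<open>i \<mapsto> j\<close> injective,
  hence a permutation.\<close>

lemma bij_betw_permutation_pairing:
  "bij_betw permutation_pairing {\<sigma>. \<sigma> permutes {0..<m}}
    {\<pi> \<in> pairings (a ` {0..<m} \<union> b ` {0..<m}). \<forall>p\<in>\<pi>. card (p \<inter> a ` {0..<m}) = 1}"
  (is "bij_betw _ _ {\<pi> \<in> pairings ?S. ?transversal \<pi>}")
proof (rule bij_betwI')
  fix \<sigma> \<tau> assume "\<sigma> \<in> {\<sigma>. \<sigma> permutes {0..<m}}" "\<tau> \<in> {\<sigma>. \<sigma> permutes {0..<m}}"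
  then have \<sigma>: "\<sigma> permutes {0..<m}" and \<tau>: "\<tau> permutes {0..<m}"
    by auto
  show "permutation_pairing \<sigma> = permutation_pairing \<tau> \<longleftrightarrow> \<sigma> = \<tau>"
  proof
    assume eq: "permutation_pairing \<sigma> = permutation_pairing \<tau>"
    show "\<sigma> = \<tau>"
    proof
      fix i
      show "\<sigma> i = \<tau> i"
      proof (cases "i < m")
        case True
        then have "{a i, b (\<sigma> i)} \<in> permutation_pairing \<tau>"
          unfolding eq[symmetric] by (simp add: permutation_pairing_def)
        then obtain j where j: "j < m" "{a i, b (\<sigma> i)} = {a j, b (\<tau> j)}"
          by (auto simp: permutation_pairing_def)
        then show ?thesis
          using iffD1[OF pair_eq_iff[OF True permutes_less[OF \<sigma> True] j(1) permutes_less[OF \<tau> j(1)]]]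
          by auto
      next
        case False
        then show ?thesis
          using permutes_not_in[OF \<sigma>, of i] permutes_not_in[OF \<tau>, of i] by simp
      qed
    qed
  qed simp
next
  fix \<sigma> assume "\<sigma> \<in> {\<sigma>. \<sigma> permutes {0..<m}}"
  then have \<sigma>: "\<sigma> permutes {0..<m}"
    by simp
  have "permutation_pairing \<sigma> \<in> pairings ?S"
  proof (rule pairingsI)
    have "b ` {0..<m} = b ` \<sigma> ` {0..<m}"
      by (simp add: permutes_image[OF \<sigma>])
    then show "\<Union>(permutation_pairing \<sigma>) = ?S"
      by (auto simp: permutation_pairing_def)
    show "disjoint (permutation_pairing \<sigma>)"
    proof (rule disjointI)
      fix p q assume "p \<in> permutation_pairing \<sigma>" "q \<in> permutation_pairing \<sigma>" "p \<noteq> q"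
      then obtain i j where ij: "i < m" "j < m" "p = {a i, b (\<sigma> i)}" "q = {a j, b (\<sigma> j)}"
        unfolding permutation_pairing_def by (elim imageE) simp
      moreover have "i \<noteq> j"
        using \<open>p \<noteq> q\<close> ij by auto
      moreover have "\<sigma> i < m" "\<sigma> j < m" "\<sigma> i \<noteq> \<sigma> j"
        using ij \<open>i \<noteq> j\<close> permutes_less[OF \<sigma>] permutes_inj[OF \<sigma>] by (auto dest: injD)
      ultimately have "a i \<noteq> a j" "b (\<sigma> i) \<noteq> b (\<sigma> j)" "a i \<noteq> b (\<sigma> j)" "b (\<sigma> i) \<noteq> a j"
        using a_neq_b[of i "\<sigma> j"] a_neq_b[of j "\<sigma> i"] by (simp_all add: a_eq_iff b_eq_iff)
      then show "p \<inter> q = {}"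
        unfolding ij(3,4) by simp
    qed
    show "card p = 2" if p: "p \<in> permutation_pairing \<sigma>" for p
    proof -
      obtain i where "i < m" "p = {a i, b (\<sigma> i)}"
        using p by (auto simp: permutation_pairing_def)
      then show ?thesis
        using a_neq_b[of i "\<sigma> i"] permutes_less[OF \<sigma>, of i] by simp
    qed
  qed
  moreover have "?transversal (permutation_pairing \<sigma>)"
  proof
    fix p assume "p \<in> permutation_pairing \<sigma>"
    then obtain i where i: "i < m" "p = {a i, b (\<sigma> i)}"
      by (auto simp: permutation_pairing_def)
    then show "card (p \<inter> a ` {0..<m}) = 1"
      unfolding i(2) pair_Int[OF i(1) permutes_less[OF \<sigma> i(1)]] by simp
  qed
  ultimately show "permutation_pairing \<sigma> \<in> {\<pi> \<in> pairings ?S. ?transversal \<pi>}"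
    by simp
next
  fix \<pi> assume "\<pi> \<in> {\<pi> \<in> pairings ?S. ?transversal \<pi>}"
  then have pairing: "\<pi> \<in> pairings ?S" and trans: "?transversal \<pi>"
    by auto
  note \<pi> = pairingsD[OF pairing]
  have form: "\<exists>i j. i < m \<and> j < m \<and> p = {a i, b j}" if p: "p \<in> \<pi>" for p
  proof -
    obtain u v where uv: "p = {u, v}" "u \<noteq> v"
      using \<pi>(3)[OF p] by (meson card_2_iff)
    obtain w where w: "p \<inter> a ` {0..<m} = {w}"
      using trans p by (auto simp: card_1_singleton_iff)
    define w' where "w' = (if w = u then v else u)"
    have p': "p = {w, w'}" "w \<noteq> w'"
      using w uv by (auto simp: w'_def)
    have "w' \<notin> a ` {0..<m}"
    proof
      assume "w' \<in> a ` {0..<m}"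
      then have "w' \<in> p \<inter> a ` {0..<m}"
        using p'(1) by simp
      then show False
        using w p'(2) by simp
    qed
    moreover have "w' \<in> ?S"
      using p'(1) \<pi>(1) p by blast
    moreover have "w \<in> a ` {0..<m}"
      using w by blast
    ultimately obtain i j where "i < m" "w = a i" "j < m" "w' = b j"
      by auto
    then show ?thesis
      using p'(1) by blast
  qed
  have "\<exists>j < m. {a i, b j} \<in> \<pi>" if i: "i < m" for i
  proof -
    have "a i \<in> \<Union>\<pi>"
      using i \<pi>(1) by auto
    then obtain p where p: "p \<in> \<pi>" "a i \<in> p"
      by auto
    then obtain i' j where ij: "i' < m" "j < m" "p = {a i', b j}"
      using form by metis
    then have "a i = a i'"
      using p(2) a_neq_b[OF i ij(2)] by auto
    then show ?thesis
      using ij p(1) by auto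
  qed
  then obtain f where f: "\<And>i. i < m \<Longrightarrow> f i < m \<and> {a i, b (f i)} \<in> \<pi>"
    by metis
  \<comment> \<open>Outside the index range \<open>permutes\<close> demands the identity.\<close>
  define \<sigma> where "\<sigma> i = (if i < m then f i else i)" for i
  have same: "i = j" if "i < m" "j < m" "f i = f j" for i j
  proof -
    have "{a i, b (f i)} = {a j, b (f j)}"
      using disjointD[OF \<pi>(2), of "{a i, b (f i)}" "{a j, b (f j)}"] f[OF that(1)] f[OF that(2)] that(3)
      by auto
    then show ?thesis
      using pair_eq_iff[of i "f i" j "f j"] f that(1,2) by simp
  qed
  have "inj_on \<sigma> {0..<m}"
    using same by (auto simp: \<sigma>_def intro: inj_onI)
  moreover have "\<sigma> ` {0..<m} \<subseteq> {0..<m}"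
    using f by (auto simp: \<sigma>_def)
  ultimately have \<sigma>: "\<sigma> permutes {0..<m}"
    by (intro bij_imp_permutes) (simp_all add: bij_betw_def endo_inj_surj, simp add: \<sigma>_def)
  have "\<pi> = permutation_pairing \<sigma>"
  proof
    show "permutation_pairing \<sigma> \<subseteq> \<pi>"
      using f by (auto simp: permutation_pairing_def \<sigma>_def)
    show "\<pi> \<subseteq> permutation_pairing \<sigma>"
    proof
      fix p assume p: "p \<in> \<pi>"
      then obtain i j where ij: "i < m" "j < m" "p = {a i, b j}"
        using form by metis
      then have "p = {a i, b (f i)}"
        using disjointD[OF \<pi>(2) p, of "{a i, b (f i)}"] f[OF ij(1)] by auto
      then show "p \<in> permutation_pairing \<sigma>"
        using ij by (auto simp: permutation_pairing_def \<sigma>_def)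
    qed
  qed
  then show "\<exists>\<sigma>\<in>{\<sigma>. \<sigma> permutes {0..<m}}. \<pi> = permutation_pairing \<sigma>"
    using \<sigma> by auto
qed

lemma sum_transversal_pairings_eq_det:
  assumes "\<And>u v. c u v = c v u"
  shows "(\<Sum>\<pi> | \<pi> \<in> pairings (a ` {0..<m} \<union> b ` {0..<m}) \<and> (\<forall>p\<in>\<pi>. card (p \<inter> a ` {0..<m}) = 1).
      pairing_weight (skew_matrix c) \<pi>) =
    Determinant.det (Matrix.mat m m (\<lambda>(i, j).
      (-1) ^ card {w \<in> a ` {0..<m}. min (a i) (b j) < w \<and> w < max (a i) (b j)} * c (a i) (b j)))"
proof -
  have "(\<Sum>\<pi> | \<pi> \<in> pairings (a ` {0..<m} \<union> b ` {0..<m}) \<and> (\<forall>p\<in>\<pi>. card (p \<inter> a ` {0..<m}) = 1).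
      pairing_weight (skew_matrix c) \<pi>) =
    (\<Sum>\<sigma> | \<sigma> permutes {0..<m}. pairing_weight (skew_matrix c) (permutation_pairing \<sigma>))"
    by (rule sum.reindex_bij_betw[OF bij_betw_permutation_pairing, of "pairing_weight (skew_matrix c)", symmetric])
  also have "\<dots> = Determinant.det (Matrix.mat m m (\<lambda>(i, j).
      (-1) ^ card {w \<in> a ` {0..<m}. min (a i) (b j) < w \<and> w < max (a i) (b j)} * c (a i) (b j)))"
    \<comment> \<open>The Leibniz formula in the form with entries \<open>(i, \<sigma> i)\<close>
      matches the weights term by term.\<close>
    unfolding det_def'[OF mat_carrier]
  proof (intro sum.cong refl)
    fix \<sigma> assume "\<sigma> \<in> {\<sigma>. \<sigma> permutes {0..<m}}"
    then have \<sigma>: "\<sigma> permutes {0..<m}"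
      by simp
    show "pairing_weight (skew_matrix c) (permutation_pairing \<sigma>) = signof \<sigma> *
      (\<Prod>i = 0..<m. Matrix.mat m m (\<lambda>(i, j).
        (-1) ^ card {w \<in> a ` {0..<m}. min (a i) (b j) < w \<and> w < max (a i) (b j)} * c (a i) (b j))
          $$ (i, \<sigma> i))"
      unfolding pairing_weight_permutation_pairing[OF \<sigma>, OF assms]
      by (intro arg_cong2[where f = "(*)"] refl prod.cong) (use permutes_less[OF \<sigma>] in simp)
  qed
  finally show ?thesis .
qed

end

section \<open>Specialization to sources and sinks\<close>

lemma sources_Un_sinks: "sources n B \<union> sinks n B = nodes n"
  by (auto simp: sources_def sinks_def odd_nodes_def even_nodes_def)

lemma nodes_Diff_sources: "nodes n - sources n B = sinks n B"
  by (auto simp: sources_def sinks_def odd_nodes_def even_nodes_def)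

text \<open>The sequences \<open>a\<close> and \<open>b\<close> become the sorted lists of sources
  and sinks, which are increasing and have disjoint ranges.\<close>

lemma sum_source_sink_pairings_eq_det:
  assumes card: "card (sources n B) = card (sinks n B)" and sym: "\<And>u v. c u v = c v u"
  shows "(\<Sum>\<pi> | \<pi> \<in> pairings (nodes n) \<and> (\<forall>p\<in>\<pi>. card (p \<inter> sources n B) = 1).
      pairing_weight (skew_matrix c) \<pi>) = Determinant.det (source_sink_matrix c n B)"
proof -
  let ?P = "sources n B" and ?Q = "sinks n B"
  let ?a = "\<lambda>i. sorted_list_of_set ?P ! i" and ?b = "\<lambda>i. sorted_list_of_set ?Q ! i"
  have fin: "finite ?P" "finite ?Q"
    by (simp_all add: sources_def sinks_def odd_nodes_def even_nodes_def nodes_def)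
  have image: "(\<lambda>i. sorted_list_of_set A ! i) ` {0..<card A} = A" if "finite A" for A :: "nat set"
    using nth_image[of "card A" "sorted_list_of_set A"] that by (simp add: atLeast0LessThan)
  have mono: "sorted_list_of_set A ! i < sorted_list_of_set A ! j"
    if "i < j" "j < card A" for A :: "nat set" and i j
    using sorted_wrt_nth_less[OF strict_sorted_list_of_set[of A]] that by simp
  have a: "?a ` {0..<card ?P} = ?P" and b: "?b ` {0..<card ?P} = ?Q"
    using image[OF fin(1)] image[OF fin(2)] card by simp_all
  have neq: "?a i \<noteq> ?b j" if "i < card ?P" "j < card ?P" for i j
  proof -
    have "?a i \<in> ?a ` {0..<card ?P}" "?b j \<in> ?b ` {0..<card ?P}"
      using that by (intro imageI; simp)+
    then have "?a i \<in> ?P" "?b j \<in> nodes n - ?P"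
      by (simp_all only: a b nodes_Diff_sources)
    then show ?thesis
      by (metis DiffD2)
  qed
  have "source_sink_matrix c n B = Matrix.mat (card ?P) (card ?P) (\<lambda>(i, j).
      (-1) ^ card {w \<in> ?P. min (?a i) (?b j) < w \<and> w < max (?a i) (?b j)} * c (?a i) (?b j))"
    \<comment> \<open>Equality of the cardinalities makes the matrix visibly square.\<close>
    unfolding source_sink_matrix_def sources_between_def Let_def card[symmetric] ..
  moreover have "?b i < ?b j" if "i < j" "j < card ?P" for i j
    using mono[of i j ?Q] that card by simp
  ultimately show ?thesis
    using sum_transversal_pairings_eq_det[of "card ?P" ?a ?b c, OF mono _ neq sym]
    unfolding a b sources_Un_sinks by (simp only:)
qed

lemma sum_pf_mult_pf_eq_det:
  assumes sym: "\<And>u v. c u v = c v u"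
  shows "(\<Sum>S\<in>even_subsets (nodes n).
      (-1) ^ card (S \<inter> B) * pf (skew_matrix c) S * pf (skew_matrix c) (nodes n - S)) =
    (if card (sources n B) = card (sinks n B)
     then 2 ^ (card (nodes n) div 2) * Determinant.det (source_sink_matrix c n B) else 0)"
proof -
  let ?trans = "\<lambda>\<pi>. \<forall>p\<in>\<pi>. card (p \<inter> sources n B) = 1"
  have fin: "finite (nodes n)"
    by (simp add: nodes_def)
  have "(\<Sum>S\<in>even_subsets (nodes n).
      (-1) ^ card (S \<inter> B) * pf (skew_matrix c) S * pf (skew_matrix c) (nodes n - S)) =
    (\<Sum>\<pi>\<in>pairings (nodes n). if ?trans \<pi> then 2 ^ n * pairing_weight (skew_matrix c) \<pi> else 0)"
    unfolding sum_pf_mult_pf[OF fin] by (intro sum.cong refl sum_Pow_pairing_weight)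
  also have "\<dots> = 2 ^ n * (\<Sum>\<pi> | \<pi> \<in> pairings (nodes n) \<and> ?trans \<pi>. pairing_weight (skew_matrix c) \<pi>)"
    unfolding sum_distrib_left
    by (rule sum.inter_filter[symmetric]) (rule finite_pairings[OF fin])
  also have "\<dots> = (if card (sources n B) = card (sinks n B)
     then 2 ^ (card (nodes n) div 2) * Determinant.det (source_sink_matrix c n B) else 0)"
  proof (cases "card (sources n B) = card (sinks n B)")
    case True
    then show ?thesis
      unfolding sum_source_sink_pairings_eq_det[OF True sym] by (simp add: nodes_def)
  next
    case False
    have "sources n B \<subseteq> nodes n"
      using sources_Un_sinks by blast
    \<comment> \<open>A surviving pairing would match sources with sinks bijectively, so none
      exists.\<close>
    then have "{\<pi> \<in> pairings (nodes n). ?trans \<pi>} = {}"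
      using card_eq_of_transversal_pairing[OF _ fin, of _ "sources n B"] False
      by (auto simp: nodes_Diff_sources)
    then show ?thesis
      by (simp only: False sum.empty mult_zero_right if_False)
  qed
  finally show ?thesis .
qed

theorem proposition8:
  fixes V :: "'v set" and E :: "'v set set"
    and pos :: "'v \<Rightarrow> complex" and curve :: "'v set \<Rightarrow> real \<Rightarrow> complex"
    and J U :: "'v set \<Rightarrow> real"
    and n :: nat and x :: "nat \<Rightarrow> 'v" and B :: "nat set"
  assumes "plane_graph V E pos curve"
    and "boundary_nodes V E pos curve n x"
    and "coloring n x B"
  shows "(\<Sum>S\<in>even_subsets (nodes n).
      (-1) ^ card (S \<inter> B) * pf (skew_matrix (node_corr V E J U x)) S
                            * pf (skew_matrix (node_corr V E J U x)) (nodes n - S)) =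
    (if card (sources n B) = card (sinks n B)
     then 2 ^ (card (nodes n) div 2) *
            Determinant.det (source_sink_matrix (node_corr V E J U x) n B)
     else 0)"
  \<comment> \<open>The correlations are symmetric because the product of two spins is
    commutative.\<close>
  by (rule sum_pf_mult_pf_eq_det) (simp add: node_corr_def AT_corr_def mult.commute)

end
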